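(* Let $d$ be a natural number. Let $H$ be any simple (unlooped) graph with no $(d+1)$-clique. Let $G$ be any connected $d$-regular graph on $n<2d$ vertices such that $\hom(G,H)>0$ (this implies that $G$ is unlooped). Then there exists a natural number $k$ such that $$\hom(G, kH) > \hom(K_{d+1}, kH)^{\frac{n}{d+1}}$$ and $$\hom(G, kH) > \hom(K_{d,d}, kH)^{\frac{n}{2d}}.$$
   Context: All graphs are finite and undirected, without multiple edges. A homomorphism from $G$ to $H$ is a map $\phi:V(G)\to V(H)$ such that $\phi(u)\phi(v)\in E(H)$ for every edge (including loops) $uv\in E(G)$; $\hom(G,H)$ is the number of homomorphisms from $G$ to $H$. $K_{d+1}$ is the complete loop-free graph on $d+1$ vertices, $K_{d,d}$ is the complete bipartite graph with parts of size $d$, and $kH$ is the disjoint union of $k$ copies of $H$. *)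

theory Defs
  imports Complex_Main "HOL-Library.FuncSet" "Graph_Theory.Graph_Theory"
begin

text \<open>
  An undirected graph without multiple edges is a symmetric \<open>pair_pre_digraph\<close>:
  \<^locale>\<open>pair_pseudo_graph\<close> is a finite graph in which loops are allowed, and
  \<^locale>\<open>pair_graph\<close> is a finite simple graph. \<^const>\<open>connected\<close> entails that there is
  at least one vertex.
\<close>

text \<open>
  Maps are taken in the extensional function space, so that each map from the vertices of
  \<open>G\<close> to the vertices of \<open>H\<close> is counted exactly once.
\<close>

definition homs :: "'a pair_pre_digraph \<Rightarrow> 'b pair_pre_digraph \<Rightarrow> ('a \<Rightarrow> 'b) set" where
  "homs G H = {\<phi> \<in> pverts G \<rightarrow>\<^sub>E pverts H.
     \<forall>u v. (u, v) \<in> parcs G \<longrightarrow> (\<phi> u, \<phi> v) \<in> parcs H}"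

definition hom :: "'a pair_pre_digraph \<Rightarrow> 'b pair_pre_digraph \<Rightarrow> nat" where
  "hom G H = card (homs G H)"

text \<open>
  For a symmetric digraph the out-degree is the number of neighbours; in particular a loop
  contributes 1 to the degree of its vertex.
\<close>

definition regular_graph :: "nat \<Rightarrow> 'a pair_pre_digraph \<Rightarrow> bool" where
  "regular_graph d G \<longleftrightarrow> (\<forall>v \<in> pverts G. out_degree (with_proj G) v = d)"

definition clique :: "'a pair_pre_digraph \<Rightarrow> 'a set \<Rightarrow> bool" where
  "clique H S \<longleftrightarrow> S \<subseteq> pverts H \<and> (\<forall>u \<in> S. \<forall>v \<in> S. u \<noteq> v \<longrightarrow> (u, v) \<in> parcs H)"

definition complete_graph :: "nat \<Rightarrow> nat pair_pre_digraph" where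
  "complete_graph m = \<lparr> pverts = {..<m}, parcs = {(i, j). i < m \<and> j < m \<and> i \<noteq> j} \<rparr>"

definition complete_bipartite_graph :: "nat \<Rightarrow> nat \<Rightarrow> (nat + nat) pair_pre_digraph" where
  "complete_bipartite_graph m n =
     \<lparr> pverts = {..<m} <+> {..<n},
       parcs = (Inl ` {..<m}) \<times> (Inr ` {..<n}) \<union> (Inr ` {..<n}) \<times> (Inl ` {..<m}) \<rparr>"

definition copies :: "nat \<Rightarrow> 'a pair_pre_digraph \<Rightarrow> (nat \<times> 'a) pair_pre_digraph" where
  "copies k H =
     \<lparr> pverts = {..<k} \<times> pverts H,
       parcs = {((i, u), (i, v)) | i u v. i < k \<and> (u, v) \<in> parcs H} \<rparr>"

lemma complete_graph_correct: "complete_digraph m (with_proj (complete_graph m))"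
  unfolding complete_digraph_pair_def by (auto simp: complete_graph_def)

lemma complete_bipartite_graph_correct:
  "complete_bipartite_digraph m n (with_proj (complete_bipartite_graph m n))"
  unfolding complete_bipartite_digraph_pair_def
  apply (simp add: complete_bipartite_graph_def)
  apply (rule exI[of _ "Inl ` {..<m}"], rule exI[of _ "Inr ` {..<n}"])
  by (auto simp: card_image)

lemma pair_graph_copies:
  assumes "pair_graph H"
  shows "pair_graph (copies k H)"
proof -
  interpret pair_graph H by fact
  have sub: "parcs (copies k H) \<subseteq> pverts (copies k H) \<times> pverts (copies k H)"
    by (auto simp: copies_def dest: in_arcsD1 in_arcsD2)
  have fin: "finite (pverts (copies k H))"
    by (simp add: copies_def)
  show ?thesis
  proof
    show "finite (parcs (copies k H))"
      using sub fin by (meson finite_SigmaI finite_subset)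
    show "symmetric (with_proj (copies k H))"
      by (auto simp: symmetric_def copies_def sym_def dest: arcs_symmetric)
  qed (use fin in \<open>auto simp: copies_def dest: in_arcsD1 in_arcsD2 no_loops'\<close>)
qed

end

theory Submission
  imports Defs
begin

text \<open>
  A homomorphism from \<open>K\<^sub>d\<^sub>+\<^sub>1\<close> to the loopless graph \<open>kH\<close> would produce a \<open>(d + 1)\<close>-clique in
  one of the copies of \<open>H\<close>, so the first right-hand side vanishes. As
  \<open>K\<^sub>d\<^sub>,\<^sub>d\<close> is connected, \<open>hom(K\<^sub>d\<^sub>,\<^sub>d, kH)\<close> is at most \<open>k hom(K\<^sub>d\<^sub>,\<^sub>d, H)\<close>, whereas
  \<open>hom(G, kH) \<ge> k hom(G, H) \<ge> k\<close>. With \<open>c = hom(K\<^sub>d\<^sub>,\<^sub>d, H)\<close> it remains to choose \<open>k\<close> with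
  \<open>(kc)\<^sup>n < k\<^sup>2\<^sup>d\<close>, and since \<open>n < 2d\<close> any \<open>k > c\<^sup>n\<close> will do.
\<close>

lemma finite_homs:
  assumes "finite (pverts G)" "finite (pverts H)"
  shows "finite (homs G H)"
  unfolding homs_def using assms by (simp add: finite_PiE)

text \<open>A homomorphism into \<open>H\<close> can be placed in any of the \<open>k\<close>
  copies. A vertex of \<open>G\<close> is needed to read off the chosen copy: on an empty
  \<open>G\<close> all placements coincide.\<close>

lemma mult_hom_le_hom_copies:
  fixes G :: "'a pair_pre_digraph" and H :: "'b pair_pre_digraph"
  assumes "finite (pverts G)" "finite (pverts H)" "pverts G \<noteq> {}"
    and wf: "parcs G \<subseteq> pverts G \<times> pverts G"
  shows "k * hom G H \<le> hom G (copies k H)"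
proof -
  define F where "F = (\<lambda>(i :: nat, \<psi> :: 'a \<Rightarrow> 'b). \<lambda>x\<in>pverts G. (i, \<psi> x))"
  have "inj_on F ({..<k} \<times> homs G H)"
  proof (rule inj_onI, clarify)
    fix i j \<psi> \<chi>
    assume mem: "\<psi> \<in> homs G H" "\<chi> \<in> homs G H" and eq: "F (i, \<psi>) = F (j, \<chi>)"
    have *: "i = j \<and> \<psi> x = \<chi> x" if "x \<in> pverts G" for x
      using fun_cong[OF eq, of x] that by (simp add: F_def)
    moreover have "\<psi> = \<chi>"
      using mem * by (auto simp: homs_def intro: PiE_ext)
    ultimately show "i = j \<and> \<psi> = \<chi>"
      using assms(3) by blast
  qed
  moreover have "F ` ({..<k} \<times> homs G H) \<subseteq> homs G (copies k H)"
    using wf by (fastforce simp: F_def homs_def copies_def)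
  moreover have "finite (homs G (copies k H))"
    using assms by (intro finite_homs) (simp_all add: copies_def)
  ultimately have "card ({..<k} \<times> homs G H) \<le> card (homs G (copies k H))"
    by (rule card_inj_on_le)
  then show ?thesis
    by (simp add: hom_def card_cartesian_product)
qed

text \<open>A connected graph is mapped into a single copy, so a homomorphism is determined by the
  copy containing the image of \<open>r\<close> and by its projection to \<open>H\<close>.
  Connectedness enters as \<open>conn\<close>: labels that agree along arcs agree everywhere. This
  is applied to the copy index.\<close>

lemma hom_copies_le:
  fixes G :: "'a pair_pre_digraph" and H :: "'b pair_pre_digraph"
  assumes "finite (pverts G)" "finite (pverts H)" "r \<in> pverts G"
    and wf: "parcs G \<subseteq> pverts G \<times> pverts G"
    and conn: "\<And>(f :: 'a \<Rightarrow> nat) v. (\<And>u v. (u, v) \<in> parcs G \<Longrightarrow> f u = f v) \<Longrightarrow>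
                 v \<in> pverts G \<Longrightarrow> f v = f r"
  shows "hom G (copies k H) \<le> k * hom G H"
proof -
  define F where "F = (\<lambda>\<phi> :: 'a \<Rightarrow> nat \<times> 'b. (fst (\<phi> r), \<lambda>x\<in>pverts G. snd (\<phi> x)))"
  \<comment> \<open>Arcs of \<open>copies k H\<close> never change the copy index, so
    \<open>conn\<close> applies to the index of the image.\<close>
  have const: "fst (\<phi> v) = fst (\<phi> r)" if "\<phi> \<in> homs G (copies k H)" "v \<in> pverts G" for \<phi> v
    using that by (intro conn[of "\<lambda>v. fst (\<phi> v)"]) (fastforce simp: homs_def copies_def)+
  have "inj_on F (homs G (copies k H))"
  proof (rule inj_onI)
    fix \<phi> \<chi>
    assume mem: "\<phi> \<in> homs G (copies k H)" "\<chi> \<in> homs G (copies k H)" and eq: "F \<phi> = F \<chi>"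
    have "\<phi> x = \<chi> x" if x: "x \<in> pverts G" for x
    proof (rule prod_eqI)
      show "fst (\<phi> x) = fst (\<chi> x)"
        using const[OF mem(1) x] const[OF mem(2) x] eq by (simp add: F_def)
      show "snd (\<phi> x) = snd (\<chi> x)"
        using fun_cong[OF arg_cong[OF eq, of snd], of x] x by (simp add: F_def)
    qed
    then show "\<phi> = \<chi>"
      using mem by (auto simp: homs_def intro: PiE_ext)
  qed
  moreover have "F \<phi> \<in> {..<k} \<times> homs G H" if \<phi>: "\<phi> \<in> homs G (copies k H)" for \<phi>
  proof -
    have vert: "\<phi> x \<in> {..<k} \<times> pverts H" if "x \<in> pverts G" for x
      using \<phi> that by (auto simp: homs_def copies_def)
    have arc: "(snd (\<phi> u), snd (\<phi> v)) \<in> parcs H" if "(u, v) \<in> parcs G" for u v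
      using \<phi> that by (fastforce simp: homs_def copies_def)
    show ?thesis
      using vert arc assms(3) wf by (auto simp: F_def homs_def mem_Times_iff)
  qed
  then have "F ` homs G (copies k H) \<subseteq> {..<k} \<times> homs G H"
    by blast
  moreover have "finite ({..<k} \<times> homs G H)"
    using assms by (simp add: finite_homs)
  ultimately have "card (homs G (copies k H)) \<le> card ({..<k} \<times> homs G H)"
    by (rule card_inj_on_le)
  then show ?thesis
    by (simp add: hom_def card_cartesian_product)
qed

lemma hom_complete_bipartite_copies_le:
  assumes "finite (pverts H)" "m > 0" "n > 0"
  shows "hom (complete_bipartite_graph m n) (copies k H)
           \<le> k * hom (complete_bipartite_graph m n) H"
proof (rule hom_copies_le[where r = "Inl 0"])
  fix f :: "nat + nat \<Rightarrow> nat" and v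
  assume arc: "\<And>u v. (u, v) \<in> parcs (complete_bipartite_graph m n) \<Longrightarrow> f u = f v"
    and v: "v \<in> pverts (complete_bipartite_graph m n)"
  \<comment> \<open>All right vertices see \<open>Inl 0\<close>, and a left vertex reaches it
    through \<open>Inr 0\<close>; both exist as \<open>m\<close> and \<open>n\<close> are
    positive.\<close>
  have lr: "f (Inl i) = f (Inr j)" if "i < m" "j < n" for i j
    using that by (intro arc) (simp add: complete_bipartite_graph_def)
  show "f v = f (Inl 0)"
  proof (cases v)
    case (Inl i)
    then have "i < m"
      using v by (auto simp: complete_bipartite_graph_def)
    then show ?thesis
      using Inl lr[of i 0] lr[of 0 0] assms by simp
  next
    case (Inr j)
    then have "j < n"
      using v by (auto simp: complete_bipartite_graph_def)
    then show ?thesis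
      using Inr lr[of 0 j] assms by simp
  qed
qed (use assms in \<open>auto simp: complete_bipartite_graph_def\<close>)

text \<open>Two vertices with the same image would yield a loop in \<open>H\<close>, so a
  homomorphism is injective and its image is a clique of full size \<open>m\<close>.\<close>

lemma hom_complete_graph_eq_0:
  assumes "pair_graph H" and no_clique: "\<not> (\<exists>S. clique H S \<and> card S = m)"
  shows "hom (complete_graph m) H = 0"
proof -
  interpret pair_graph H by fact
  have False if \<phi>: "\<phi> \<in> homs (complete_graph m) H" for \<phi>
  proof -
    have arc: "(\<phi> i, \<phi> j) \<in> parcs H" if "i < m" "j < m" "i \<noteq> j" for i j
      using \<phi> that by (auto simp: homs_def complete_graph_def)
    have "inj_on \<phi> {..<m}"
      by (rule inj_onI) (metis arc lessThan_iff no_loops')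
    then have "card (\<phi> ` {..<m}) = m"
      by (simp add: card_image)
    moreover have "clique H (\<phi> ` {..<m})"
      using arc \<phi> by (auto simp: clique_def homs_def complete_graph_def)
    ultimately show False
      using no_clique by blast
  qed
  then have "homs (complete_graph m) H = {}"
    by blast
  then show ?thesis
    by (simp add: hom_def)
qed

text \<open>Forgetting the copy index keeps adjacency, and looplessness of \<open>H\<close> keeps
  distinct members distinct. Thus \<open>copies k H\<close> has no larger cliques than
  \<open>H\<close>.\<close>

lemma clique_copies_image_snd:
  assumes "pair_graph H" "clique (copies k H) S"
  shows "clique H (snd ` S)" "inj_on snd S"
proof -
  interpret pair_graph H by fact
  have arc: "(snd u, snd v) \<in> parcs H" if "u \<in> S" "v \<in> S" "u \<noteq> v" for u v
    using assms(2) that by (fastforce simp: clique_def copies_def)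
  show "clique H (snd ` S)"
    using assms(2) arc by (fastforce simp: clique_def copies_def)
  show "inj_on snd S"
    by (rule inj_onI) (metis arc no_loops')
qed

theorem theorem5:
  fixes d n :: nat
    and G :: "'a pair_pre_digraph"
    and H :: "'b pair_pre_digraph"
  assumes "pair_graph H"
    and "\<not> (\<exists>S. clique H S \<and> card S = d + 1)"
    and "pair_pseudo_graph G"
    and "connected (with_proj G)"
    and "regular_graph d G"
    and "card (pverts G) = n"
    and "n < 2 * d"
    and "hom G H > 0"
  shows "\<exists>k::nat.
      real (hom G (copies k H)) >
        real (hom (complete_graph (d + 1)) (copies k H)) powr (real n / real (d + 1))
    \<and> real (hom G (copies k H)) >
        real (hom (complete_bipartite_graph d d) (copies k H)) powr (real n / real (2 * d))"
proof -
  interpret H: pair_graph H by fact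
  interpret G: pair_pseudo_graph G by fact
  have d: "d > 0"
    using assms(7) by simp
  have nonempty: "pverts G \<noteq> {}"
    using assms(4) by (auto simp: connected_def strongly_connected_def)
  define c where "c = hom (complete_bipartite_graph d d) H"
  define k where "k = c ^ n + 1"
  have "k * 1 \<le> k * hom G H"
    using assms(8) by (intro mult_le_mono) auto
  also have "\<dots> \<le> hom G (copies k H)"
    using nonempty by (intro mult_hom_le_hom_copies) (auto dest: G.in_arcsD1 G.in_arcsD2)
  finally have k_le: "k \<le> hom G (copies k H)"
    by simp
  have "\<not> (\<exists>S. clique (copies k H) S \<and> card S = d + 1)"
    using clique_copies_image_snd[OF assms(1)] assms(2) by (metis card_image)
  then have K0: "hom (complete_graph (d + 1)) (copies k H) = 0"
    by (intro hom_complete_graph_eq_0 pair_graph_copies assms(1))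
  have "c ^ n < k" "k > 0"
    by (simp_all add: k_def)
  then have "(k * c) ^ n < k ^ n * k"
    by (simp add: power_mult_distrib)
  also have "\<dots> = k ^ (n + 1)"
    by simp
  \<comment> \<open>Here \<open>n < 2 * d\<close> is used as n + 1 \<le> 2d, with base k \<ge>
    1.\<close>
  also have "\<dots> \<le> k ^ (2 * d)"
    using assms(7) by (intro power_increasing) (auto simp: k_def)
  finally have less: "real (k * c) ^ n < real k ^ (2 * d)"
    by (metis of_nat_less_iff of_nat_power)
  have "real (k * c) powr (real n / real (2 * d)) < real k"
  \<comment> \<open>Rewriting powers as \<open>powr\<close> needs a positive base before the 2d-th
    root is taken. For base 0, \<open>powr\<close> returns 0, which is below
    \<open>k\<close>.\<close>
  proof (cases "k * c = 0")
    case False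
    have "real (k * c) powr (real n / real (2 * d)) = (real (k * c) ^ n) powr (1 / real (2 * d))"
      using False by (simp add: powr_powr flip: powr_realpow)
    also have "\<dots> < (real k ^ (2 * d)) powr (1 / real (2 * d))"
      using less d by (intro powr_less_mono2) auto
    also have "\<dots> = real k"
      using d \<open>k > 0\<close> by (simp add: powr_powr flip: powr_realpow)
    finally show ?thesis .
  qed (use \<open>k > 0\<close> in simp)
  moreover have "real (hom (complete_bipartite_graph d d) (copies k H)) powr (real n / real (2 * d))
      \<le> real (k * c) powr (real n / real (2 * d))"
    unfolding c_def using d
    by (intro powr_mono2 of_nat_mono hom_complete_bipartite_copies_le) auto
  \<comment> \<open>By \<open>K0\<close> the first right-hand side is a \<open>powr\<close> with
    base 0, hence 0, while the left-hand side is at least k > 0.\<close>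
  ultimately show ?thesis
    using k_le K0 \<open>k > 0\<close> by (intro exI[of _ k]) auto
qed

end
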